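(* Let $\alpha:\mathbb R\to\mathbb R_+$ be defined by $\alpha(t)=e^{t^2}$ and let $\Gamma=\{(t,\alpha(t)): t\in\mathbb R\}\subset\mathbb R^2$. (i) If $\Lambda\subset\mathbb R^2$ is a straight line parallel to the $X$-axis, then $(\Gamma,\Lambda)$ is a Heisenberg uniqueness pair. (ii) If $\Lambda=L_1\cup L_2$, where $L_1,L_2\subset\mathbb R^2$ are any two different straight lines parallel to the $Y$-axis, then $(\Gamma,\Lambda)$ is a Heisenberg uniqueness pair.
   Context: For a curve $\Gamma\subset\mathbb R^2$ (a finite disjoint union of smooth curves), $X(\Gamma)$ denotes the space of all finite complex-valued Borel measures $\mu$ on $\mathbb R^2$ that are supported on $\Gamma$ and absolutely continuous with respect to the arc length measure on $\Gamma$. The Fourier transform of $\mu$ is $\hat\mu(\xi,\eta)=\int_\Gamma e^{-i\pi(x\xi+y\eta)}\,d\mu(x,y)$ for $(\xi,\eta)\in\mathbb R^2$. For a set $\Lambda\subset\mathbb R^2$, the pair $(\Gamma,\Lambda)$ is a Heisenberg uniqueness pair (HUP) if every $\mu\in X(\Gamma)$ with $\hat\mu(\xi,\eta)=0$ for all $(\xi,\eta)\in\Lambda$ satisfies $\mu=0$. A line parallel to the $X$-axis (resp. $Y$-axis) is allowed to be the axis itself. *)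

theory Defs
  imports "HOL-Analysis.Analysis"
begin

subsection \<open>Complex Borel measures\<close>

text \<open>
  A complex measure is a countably additive complex set function on the Borel sets; such a
  function is automatically finite. Its values on non-Borel sets are irrelevant.
\<close>

definition complex_borel_measure :: "('a::topological_space set \<Rightarrow> complex) \<Rightarrow> bool" where
  "complex_borel_measure \<mu> \<longleftrightarrow>
     \<mu> {} = 0 \<and>
     (\<forall>A :: nat \<Rightarrow> 'a set. range A \<subseteq> sets borel \<longrightarrow> disjoint_family A \<longrightarrow>
        (\<lambda>n. \<mu> (A n)) sums \<mu> (\<Union>n. A n))"

text \<open>
  The positive part of the Jordan decomposition of a signed measure \<open>\<nu>\<close>, that is
  \<open>\<nu>\<^sup>+(A) = sup {\<nu>(B) | B \<subseteq> A Borel}\<close>. Here \<open>ennreal\<close> truncates negative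
  values to \<open>0 = \<nu>({})\<close>, which does not affect the supremum. The negative part is
  \<open>upper_variation (- \<nu>)\<close>.
\<close>

definition upper_variation :: "('a::topological_space set \<Rightarrow> real) \<Rightarrow> 'a measure" where
  "upper_variation \<nu> =
     measure_of UNIV (sets borel) (\<lambda>A. SUP B\<in>{B \<in> sets borel. B \<subseteq> A}. ennreal (\<nu> B))"

definition complex_measure_integral ::
    "('a::topological_space set \<Rightarrow> complex) \<Rightarrow> ('a \<Rightarrow> complex) \<Rightarrow> complex" where
  "complex_measure_integral \<mu> f =
     ((\<integral>x. f x \<partial>upper_variation (\<lambda>A. Re (\<mu> A)))
       - (\<integral>x. f x \<partial>upper_variation (\<lambda>A. - Re (\<mu> A))))
     + \<i> * ((\<integral>x. f x \<partial>upper_variation (\<lambda>A. Im (\<mu> A)))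
       - (\<integral>x. f x \<partial>upper_variation (\<lambda>A. - Im (\<mu> A))))"

text \<open>
  For a measure supported on a curve \<open>\<Gamma>\<close>, integrating over the whole plane is integrating
  over \<open>\<Gamma>\<close>.
\<close>

definition fourier_transform :: "((real \<times> real) set \<Rightarrow> complex) \<Rightarrow> real \<times> real \<Rightarrow> complex" where
  "fourier_transform \<mu> = (\<lambda>(\<xi>, \<eta>).
     complex_measure_integral \<mu>
       (\<lambda>(x, y). exp (- \<i> * complex_of_real pi * complex_of_real (x * \<xi> + y * \<eta>))))"

subsection \<open>Smooth curves and arc length\<close>

definition smooth_on_interval :: "real set \<Rightarrow> (real \<Rightarrow> real \<times> real) \<Rightarrow> bool" where
  "smooth_on_interval I \<gamma> \<longleftrightarrow>
     (\<exists>D :: nat \<Rightarrow> real \<Rightarrow> real \<times> real. D 0 = \<gamma> \<and>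
        (\<forall>n. \<forall>t\<in>I. (D n has_vector_derivative D (Suc n) t) (at t within I)))"

text \<open>
  A regular injective smooth parametrization on an interval of any kind. A closed curve is
  covered by a half-open interval.
\<close>

definition smooth_curve_param :: "real set \<Rightarrow> (real \<Rightarrow> real \<times> real) \<Rightarrow> bool" where
  "smooth_curve_param I \<gamma> \<longleftrightarrow>
     is_interval I \<and> interior I \<noteq> {} \<and> inj_on \<gamma> I \<and> smooth_on_interval I \<gamma> \<and>
     (\<forall>t\<in>I. vector_derivative \<gamma> (at t within I) \<noteq> 0)"

text \<open>The image under \<open>\<gamma>\<close> of \<open>\<bar>\<gamma>'(t)\<bar> dt\<close> on \<open>I\<close>.\<close>

definition param_arc_length :: "real set \<Rightarrow> (real \<Rightarrow> real \<times> real) \<Rightarrow> (real \<times> real) measure" where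
  "param_arc_length I \<gamma> =
     distr (density (restrict_space lborel I)
              (\<lambda>t. ennreal (norm (vector_derivative \<gamma> (at t within I)))))
       borel \<gamma>"

text \<open>
  \<open>\<Gamma>\<close> is a finite disjoint union of smooth curves and \<open>M\<close> is its arc length measure.
  The measure \<open>M\<close> is determined by \<open>\<Gamma>\<close>: it does not depend on the decomposition of
  \<open>\<Gamma>\<close> or on the parametrizations.
\<close>

definition is_arc_length_measure :: "(real \<times> real) set \<Rightarrow> (real \<times> real) measure \<Rightarrow> bool" where
  "is_arc_length_measure \<Gamma> M \<longleftrightarrow>
     (\<exists>(n::nat) I \<gamma>.
        (\<forall>k<n. smooth_curve_param (I k) (\<gamma> k)) \<and>
        disjoint_family_on (\<lambda>k. \<gamma> k ` I k) {..<n} \<and>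
        \<Gamma> = (\<Union>k<n. \<gamma> k ` I k) \<and>
        sets M = sets borel \<and>
        (\<forall>A\<in>sets borel. emeasure M A = (\<Sum>k<n. emeasure (param_arc_length (I k) (\<gamma> k)) A)))"

definition smooth_curve :: "(real \<times> real) set \<Rightarrow> bool" where
  "smooth_curve \<Gamma> \<longleftrightarrow> (\<exists>M. is_arc_length_measure \<Gamma> M)"

subsection \<open>Heisenberg uniqueness pairs\<close>

definition X_space :: "(real \<times> real) set \<Rightarrow> ((real \<times> real) set \<Rightarrow> complex) set" where
  "X_space \<Gamma> = {\<mu>. complex_borel_measure \<mu> \<and>
     (\<forall>A\<in>sets borel. A \<inter> \<Gamma> = {} \<longrightarrow> \<mu> A = 0) \<and>
     (\<exists>M. is_arc_length_measure \<Gamma> M \<and> (\<forall>A\<in>null_sets M. \<mu> A = 0))}"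

definition heisenberg_uniqueness_pair :: "(real \<times> real) set \<Rightarrow> (real \<times> real) set \<Rightarrow> bool" where
  "heisenberg_uniqueness_pair \<Gamma> \<Lambda> \<longleftrightarrow>
     smooth_curve \<Gamma> \<and>
     (\<forall>\<mu>\<in>X_space \<Gamma>. (\<forall>p\<in>\<Lambda>. fourier_transform \<mu> p = 0) \<longrightarrow> (\<forall>A\<in>sets borel. \<mu> A = 0))"

text \<open>A line parallel to an axis may be that axis itself.\<close>

definition line_parallel_X_axis :: "(real \<times> real) set \<Rightarrow> bool" where
  "line_parallel_X_axis L \<longleftrightarrow> (\<exists>c. L = {(x, y). y = c})"

definition line_parallel_Y_axis :: "(real \<times> real) set \<Rightarrow> bool" where
  "line_parallel_Y_axis L \<longleftrightarrow> (\<exists>c. L = {(x, y). x = c})"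

end

theory Submission
  imports Defs "HOL-Probability.Levy" "HOL-Computational_Algebra.Polynomial"
begin

text \<open>
  By the Jordan decomposition and the Radon--Nikodym theorem, a complex measure has the form
  \<open>\<rho> dM\<close> with \<open>M\<close> finite. If the Fourier transform vanishes on a horizontal line, the uniqueness
  theorem for characteristic functions shows that \<open>\<rho>\<close>, twisted by a unimodular factor, integrates to
  zero against every bounded function of \<open>x\<close>; since the curve is a graph over the \<open>x\<close>-axis, \<open>\<rho> = 0\<close>.
  Vanishing on a vertical line \<open>\<xi> = s\<close> gives only that \<open>\<rho> exp (- i \<pi> s x)\<close> annihilates the functions of \<open>y\<close>, which on
  the curve are the even functions of \<open>x\<close>. For two values \<open>s = a, b\<close> the resulting linear system
  at \<open>\<plusminus>x\<close> has a determinant proportional to \<open>sin (\<pi> (b - a) x)\<close>, which vanishes only on a countable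
  set, and countable sets are null for a measure that is absolutely continuous with respect to arc length.
\<close>

subsection \<open>Signed and complex measures\<close>

text \<open>Real and imaginary parts of complex Borel measures are the intended instances. Values
  off the Borel sets are arbitrary, so each use of additivity carries Borel side conditions.\<close>

locale signed_borel_measure =
  fixes \<nu> :: "'a::topological_space set \<Rightarrow> real"
  assumes empty: "\<nu> {} = 0"
    and sums: "\<And>A :: nat \<Rightarrow> 'a set. range A \<subseteq> sets borel \<Longrightarrow> disjoint_family A \<Longrightarrow>
      (\<lambda>n. \<nu> (A n)) sums \<nu> (\<Union>n. A n)"
begin

lemma uminus: "signed_borel_measure (\<lambda>A. - \<nu> A)"
  by unfold_locales (auto simp: empty intro: sums sums_minus)

lemma Un:
  assumes "A \<in> sets borel" "B \<in> sets borel" "A \<inter> B = {}"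
  shows "\<nu> (A \<union> B) = \<nu> A + \<nu> B"
proof -
  have "(\<lambda>n. \<nu> (binaryset A B n)) sums \<nu> (\<Union>n. binaryset A B n)"
    using assms by (intro sums) (auto simp: range_binaryset_eq disjoint_family_on_def binaryset_def)
  moreover have "(\<lambda>n. \<nu> (binaryset A B n)) sums (\<nu> A + \<nu> B)"
    using empty by (intro binaryset_sums) auto
  ultimately show ?thesis
    by (simp add: UN_binaryset_eq sums_iff)
qed

lemma Diff:
  assumes "A \<in> sets borel" "B \<in> sets borel" "B \<subseteq> A"
  shows "\<nu> (A - B) = \<nu> A - \<nu> B"
proof -
  have "\<nu> (B \<union> (A - B)) = \<nu> B + \<nu> (A - B)"
    using assms by (intro Un) auto
  moreover have "B \<union> (A - B) = A" using assms by auto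
  ultimately show ?thesis by simp
qed

text \<open>
  If \<open>\<nu>\<close> is unbounded on the subsets of \<open>A\<close>, some subset \<open>B\<close> has \<open>\<bar>\<nu> B\<bar> \<ge> \<bar>\<nu> A\<bar> + 1\<close>, and then
  \<open>\<nu>\<close> is unbounded below \<open>B\<close> or below \<open>A - B\<close>, while both have measure at least \<open>1\<close> in modulus.
  Iterating yields disjoint sets whose measures do not tend to zero.
\<close>

lemma bounded: "\<exists>K. \<forall>B\<in>sets borel. \<bar>\<nu> B\<bar> \<le> K"
proof (rule ccontr)
  define unb where "unb A \<longleftrightarrow> A \<in> sets borel \<and> (\<forall>K. \<exists>B\<in>sets borel. B \<subseteq> A \<and> K < \<bar>\<nu> B\<bar>)" for A
  assume "\<nexists>K. \<forall>B\<in>sets borel. \<bar>\<nu> B\<bar> \<le> K"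
  then have start: "unb UNIV"
    unfolding unb_def by (auto simp: not_le)
  have step: "\<exists>A'. unb A' \<and> A' \<subseteq> A \<and> 1 \<le> \<bar>\<nu> (A - A')\<bar>" if A: "unb A" for A
  proof -
    have Ab: "A \<in> sets borel" using A by (simp add: unb_def)
    obtain B where B: "B \<in> sets borel" "B \<subseteq> A" "\<bar>\<nu> A\<bar> + 1 < \<bar>\<nu> B\<bar>"
      using A unfolding unb_def by blast
    have D: "\<nu> (A - B) = \<nu> A - \<nu> B" using Diff Ab B by blast
    have DB: "A - (A - B) = B" using B by auto
    have "unb B \<or> unb (A - B)"
    proof (rule ccontr)
      assume "\<not> (unb B \<or> unb (A - B))"
      then have "\<not> unb B" "\<not> unb (A - B)" by auto
      then obtain K1 K2 where K:
        "\<And>C. C \<in> sets borel \<Longrightarrow> C \<subseteq> B \<Longrightarrow> \<bar>\<nu> C\<bar> \<le> K1"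
        "\<And>C. C \<in> sets borel \<Longrightarrow> C \<subseteq> A - B \<Longrightarrow> \<bar>\<nu> C\<bar> \<le> K2"
        unfolding unb_def using Ab B(1) by (meson not_less sets.Diff)
      obtain C where C: "C \<in> sets borel" "C \<subseteq> A" "K1 + K2 < \<bar>\<nu> C\<bar>"
        using A unfolding unb_def by blast
      have "\<nu> ((C \<inter> B) \<union> (C - B)) = \<nu> (C \<inter> B) + \<nu> (C - B)"
        using B C by (intro Un) auto
      moreover have "(C \<inter> B) \<union> (C - B) = C" by auto
      moreover have "\<bar>\<nu> (C \<inter> B)\<bar> \<le> K1" "\<bar>\<nu> (C - B)\<bar> \<le> K2"
        using B C by (auto intro!: K)
      ultimately show False using C by simp
    qed
    then show ?thesis
    proof
      assume "unb B"
      then show ?thesis using B D by (intro exI[of _ B]) auto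
    next
      assume "unb (A - B)"
      then show ?thesis using B D DB by (intro exI[of _ "A - B"]) auto
    qed
  qed
  obtain S where S: "\<And>n. unb (S n)" "\<And>n. S (Suc n) \<subseteq> S n \<and> 1 \<le> \<bar>\<nu> (S n - S (Suc n))\<bar>"
    using dependent_nat_choice[of "\<lambda>_. unb" "\<lambda>_ A A'. A' \<subseteq> A \<and> 1 \<le> \<bar>\<nu> (A - A')\<bar>"]
      start step by metis
  have dec: "decseq S"
    using S by (auto intro: decseq_SucI)
  define R where "R n = S n - S (Suc n)" for n
  have "disjoint_family R"
    unfolding disjoint_family_on_def R_def
  proof (intro ballI impI)
    fix m n :: nat assume "m \<noteq> n"
    then consider "Suc m \<le> n" | "Suc n \<le> m" by linarith
    then show "(S m - S (Suc m)) \<inter> (S n - S (Suc n)) = {}"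
      using decseqD[OF dec] by cases blast+
  qed
  moreover have "range R \<subseteq> sets borel"
    using S(1) by (auto simp: R_def unb_def)
  ultimately have "(\<lambda>n. \<nu> (R n)) \<longlonglongrightarrow> 0"
    using sums summable_LIMSEQ_zero sums_summable by blast
  then have "eventually (\<lambda>n. \<bar>\<nu> (R n)\<bar> < 1) sequentially"
    using tendstoD[of "\<lambda>n. \<nu> (R n)" 0 sequentially 1] by (simp add: dist_real_def)
  moreover have "\<not> \<bar>\<nu> (R n)\<bar> < 1" for n
    using S(2)[of n] by (simp add: R_def)
  ultimately show False by simp
qed

section \<open>The positive variation as a finite measure, and the Jordan decomposition\<close>

definition pos :: "'a set \<Rightarrow> ennreal" where
  "pos A = (SUP B\<in>{B \<in> sets borel. B \<subseteq> A}. ennreal (\<nu> B))"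

lemma pos_upper: "B \<in> sets borel \<Longrightarrow> B \<subseteq> A \<Longrightarrow> ennreal (\<nu> B) \<le> pos A"
  unfolding pos_def by (rule SUP_upper) auto

lemma pos_mono: "A \<subseteq> B \<Longrightarrow> pos A \<le> pos B"
  unfolding pos_def by (rule SUP_subset_mono) auto

lemma pos_empty: "pos {} = 0"
proof -
  have "{B \<in> sets borel. B \<subseteq> {}} = {{}::'a set}" by auto
  then show ?thesis by (simp add: pos_def empty)
qed

text \<open>Competitors below \<open>A\<close> and below \<open>B\<close> are disjoint, so their
  union competes below \<open>A \<union> B\<close>. If one of them has negative measure, truncation
  makes its term zero and the other competes alone.\<close>

lemma pos_superadd:
  assumes "A \<in> sets borel" "B \<in> sets borel" "A \<inter> B = {}"
  shows "pos A + pos B \<le> pos (A \<union> B)"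
proof -
  let ?S = "\<lambda>A. {B \<in> sets borel. B \<subseteq> A} :: 'a set set"
  have ne: "?S A \<noteq> {}" for A by auto
  have *: "ennreal (\<nu> X) + ennreal (\<nu> Y) \<le> pos (A \<union> B)" if "X \<in> ?S A" "Y \<in> ?S B" for X Y
  proof -
    consider "\<nu> X \<le> 0" | "\<nu> Y \<le> 0" | "0 \<le> \<nu> X" "0 \<le> \<nu> Y" by linarith
    then show ?thesis
    proof cases
      case 1 with that show ?thesis by (auto simp: ennreal_neg intro!: pos_upper)
    next
      case 2 with that show ?thesis by (auto simp: ennreal_neg intro!: pos_upper)
    next
      case 3
      have "\<nu> (X \<union> Y) = \<nu> X + \<nu> Y" using that assms by (intro Un) auto
      then have "ennreal (\<nu> X) + ennreal (\<nu> Y) = ennreal (\<nu> (X \<union> Y))"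
        using 3 by simp
      also have "\<dots> \<le> pos (A \<union> B)" using that by (auto intro!: pos_upper)
      finally show ?thesis .
    qed
  qed
  have "pos A + pos B = (SUP Y\<in>?S B. pos A + ennreal (\<nu> Y))"
    unfolding pos_def[of B] using ne by (subst ennreal_SUP_add_right) auto
  also have "\<dots> = (SUP Y\<in>?S B. SUP X\<in>?S A. ennreal (\<nu> X) + ennreal (\<nu> Y))"
    unfolding pos_def[of A] using ne by (intro SUP_cong refl ennreal_SUP_add_left[symmetric]) auto
  also have "\<dots> \<le> pos (A \<union> B)"
    by (intro SUP_least *)
  finally show ?thesis .
qed

text \<open>Superadditivity on finite unions and monotonicity give one inequality. For the other, a
  competitor \<open>B\<close> below the union is cut into the pieces \<open>B \<inter> A n\<close>,
  each bounded by \<open>pos (A n)\<close>.\<close>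

lemma pos_countably_additive: "countably_additive (sets borel) pos"
proof (rule countably_additiveI)
  fix A :: "nat \<Rightarrow> 'a set"
  assume A: "range A \<subseteq> sets borel" "disjoint_family A" "(\<Union>i. A i) \<in> sets borel"
  show "(\<Sum>i. pos (A i)) = pos (\<Union>i. A i)"
  proof (rule antisym)
    have "(\<Sum>i<n. pos (A i)) \<le> pos (\<Union>i<n. A i)" for n
    proof (induction n)
      case (Suc n)
      have "(\<Sum>i<Suc n. pos (A i)) \<le> pos (\<Union>i<n. A i) + pos (A n)"
        using Suc by (simp add: add_right_mono)
      also have "\<dots> \<le> pos ((\<Union>i<n. A i) \<union> A n)"
      proof (intro pos_superadd)
        show "(\<Union>i<n. A i) \<inter> A n = {}"
          using disjoint_family_onD[OF A(2), of _ n] by fastforce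
      qed (use A in auto)
      also have "(\<Union>i<n. A i) \<union> A n = (\<Union>i<Suc n. A i)"
        by (auto simp: lessThan_Suc)
      finally show ?case .
    qed (simp add: pos_empty)
    also have "pos (\<Union>i<n. A i) \<le> pos (\<Union>i. A i)" for n
      by (rule pos_mono) auto
    finally show "(\<Sum>i. pos (A i)) \<le> pos (\<Union>i. A i)"
      by (intro suminf_le_const) auto
  next
    have "ennreal (\<nu> B) \<le> (\<Sum>i. pos (A i))" if B: "B \<in> sets borel" "B \<subseteq> (\<Union>i. A i)" for B
    proof -
      have "(\<lambda>n. \<nu> (B \<inter> A n)) sums \<nu> (\<Union>n. B \<inter> A n)"
        using A B by (intro sums) (auto simp: disjoint_family_on_def)
      moreover have "(\<Union>n. B \<inter> A n) = B" using B by auto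
      ultimately have lim: "(\<lambda>n. ennreal (\<Sum>i<n. \<nu> (B \<inter> A i))) \<longlonglongrightarrow> ennreal (\<nu> B)"
        by (auto simp: sums_def intro: tendsto_ennrealI)
      \<comment> \<open>Truncation at zero leaves \<open>ennreal\<close> only subadditive on the
        reals, which is the direction required here.\<close>
      have plus: "ennreal (x + y) \<le> ennreal x + ennreal y" for x y :: real
      proof (cases "0 \<le> x \<and> 0 \<le> y")
        case False
        then have "x + y \<le> x \<or> x + y \<le> y" by linarith
        then show ?thesis
          by (meson add_increasing add_increasing2 ennreal_leI order_trans zero_le order_refl)
      qed (simp add: ennreal_plus)
      have sub: "ennreal (\<Sum>i<n. f i) \<le> (\<Sum>i<n. ennreal (f i))" for n :: nat and f
      proof (induction n)
        case (Suc n)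
        show ?case
          unfolding sum.lessThan_Suc by (rule order_trans[OF plus add_right_mono[OF Suc]])
      qed simp
      have "ennreal (\<Sum>i<n. \<nu> (B \<inter> A i)) \<le> (\<Sum>i. pos (A i))" for n
      proof -
        have "(\<Sum>i<n. ennreal (\<nu> (B \<inter> A i))) \<le> (\<Sum>i<n. pos (A i))"
          using A B by (intro sum_mono pos_upper) auto
        also have "\<dots> \<le> (\<Sum>i. pos (A i))" by (rule sum_le_suminf) auto
        finally show ?thesis by (rule order_trans[OF sub])
      qed
      then show ?thesis by (intro LIMSEQ_le_const2[OF lim]) auto
    qed
    then show "pos (\<Union>i. A i) \<le> (\<Sum>i. pos (A i))"
      unfolding pos_def[of "\<Union>i. A i"] by (intro SUP_least) auto
  qed
qed

lemma sets_upper_variation [simp, measurable_cong]: "sets (upper_variation \<nu>) = sets borel"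
  unfolding upper_variation_def using sets.sigma_sets_eq[of "borel :: 'a measure"] by simp

text \<open>\<open>measure_of\<close> returns the zero measure unless its set function is countably
  additive, so the additivity of \<open>pos\<close> has to come first.\<close>

lemma emeasure_upper_variation:
  assumes "A \<in> sets borel"
  shows "emeasure (upper_variation \<nu>) A = pos A"
  unfolding upper_variation_def pos_def[symmetric, abs_def]
proof (rule emeasure_measure_of_sigma)
  show "sigma_algebra UNIV (sets borel :: 'a set set)"
    using sets.sigma_algebra_axioms[of "borel :: 'a measure"] by simp
qed (use assms in \<open>auto simp: positive_def pos_empty pos_countably_additive\<close>)

lemma finite_measure_upper_variation: "finite_measure (upper_variation \<nu>)"
proof
  obtain K where K: "\<And>B. B \<in> sets borel \<Longrightarrow> \<bar>\<nu> B\<bar> \<le> K" using bounded by blast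
  have "pos UNIV \<le> ennreal K"
    unfolding pos_def using K by (intro SUP_least ennreal_leI) (auto dest: K)
  moreover have "space (upper_variation \<nu>) = UNIV"
    using sets_eq_imp_space_eq[OF sets_upper_variation] by simp
  ultimately show "emeasure (upper_variation \<nu>) (space (upper_variation \<nu>)) \<noteq> \<infinity>"
    by (auto simp: emeasure_upper_variation top_unique)
qed

end

text \<open>For \<open>B \<subseteq> A\<close>, \<open>\<nu> B = \<nu> A - \<nu> (A - B)\<close>,
  and \<open>- \<nu> (A - B)\<close> is at most the negative variation of \<open>A\<close>. The
  supremum over \<open>B\<close> gives one inequality; exchanging the signs gives the other.\<close>

lemma (in signed_borel_measure) Jordan_decomposition:
  assumes "A \<in> sets borel"
  shows "\<nu> A = measure (upper_variation \<nu>) A - measure (upper_variation (\<lambda>A. - \<nu> A)) A"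
proof -
  interpret m: signed_borel_measure "\<lambda>A. - \<nu> A" by (rule uminus)
  interpret P: finite_measure "upper_variation \<nu>" by (rule finite_measure_upper_variation)
  interpret N: finite_measure "upper_variation (\<lambda>A. - \<nu> A)" by (rule m.finite_measure_upper_variation)
  have le: "\<nu> B \<le> measure (upper_variation \<nu>) C"
    if "B \<in> sets borel" "C \<in> sets borel" "B \<subseteq> C" for B C
    using pos_upper[OF that(1,3)] that
    by (simp flip: emeasure_upper_variation add: P.emeasure_eq_measure)
  have le': "- \<nu> B \<le> measure (upper_variation (\<lambda>A. - \<nu> A)) C"
    if "B \<in> sets borel" "C \<in> sets borel" "B \<subseteq> C" for B C
    using m.pos_upper[OF that(1,3)] that
    by (simp flip: m.emeasure_upper_variation add: N.emeasure_eq_measure)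
  \<comment> \<open>The condition \<open>0 \<le> c\<close> allows the bound \<open>ennreal c\<close>
    to be read back as the real number \<open>c\<close>.\<close>
  have least: "measure (upper_variation \<nu>) A \<le> c"
    if "\<And>B. B \<in> sets borel \<Longrightarrow> B \<subseteq> A \<Longrightarrow> \<nu> B \<le> c" "0 \<le> c" for c
  proof -
    have "pos A \<le> ennreal c"
      unfolding pos_def using that by (intro SUP_least ennreal_leI) auto
    then show ?thesis using assms that
      by (simp flip: emeasure_upper_variation add: P.emeasure_eq_measure)
  qed
  have least': "measure (upper_variation (\<lambda>A. - \<nu> A)) A \<le> c"
    if "\<And>B. B \<in> sets borel \<Longrightarrow> B \<subseteq> A \<Longrightarrow> - \<nu> B \<le> c" "0 \<le> c" for c
  proof -
    have "m.pos A \<le> ennreal c"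
      unfolding m.pos_def using that by (intro SUP_least ennreal_leI) auto
    then show ?thesis using assms that
      by (simp flip: m.emeasure_upper_variation add: N.emeasure_eq_measure)
  qed
  have "measure (upper_variation \<nu>) A \<le> \<nu> A + measure (upper_variation (\<lambda>A. - \<nu> A)) A"
  proof (rule least)
    fix B assume B: "B \<in> sets borel" "B \<subseteq> A"
    show "\<nu> B \<le> \<nu> A + measure (upper_variation (\<lambda>A. - \<nu> A)) A"
      using le'[of "A - B" A] Diff[of A B] B assms by auto
  qed (use le'[of A A] assms in auto)
  moreover have "measure (upper_variation (\<lambda>A. - \<nu> A)) A \<le> measure (upper_variation \<nu>) A - \<nu> A"
  proof (rule least')
    fix B assume B: "B \<in> sets borel" "B \<subseteq> A"
    show "- \<nu> B \<le> measure (upper_variation \<nu>) A - \<nu> A"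
      using le[of "A - B" A] Diff[of A B] B assms by auto
  qed (use le[of A A] assms in auto)
  ultimately show ?thesis by simp
qed

section \<open>Radon--Nikodym densities of complex measures\<close>

lemma (in finite_measure) real_density:
  assumes "finite_measure N" "absolutely_continuous M N" "sets N = sets M"
  obtains p :: "'a \<Rightarrow> real"
  where "p \<in> borel_measurable M" "\<And>x. 0 \<le> p x" "N = density M p" "integrable M p"
proof -
  obtain p where p: "p \<in> borel_measurable M" "AE x in M. RN_deriv M N x = ennreal (p x)" "\<And>x. 0 \<le> p x"
    using real_RN_deriv[OF assms] by metis
  have N: "N = density M p"
    using density_RN_deriv[OF assms(2,3)] p by (metis density_cong borel_measurable_RN_deriv measurable_compose measurable_ennreal)
  \<comment> \<open>The integral of \<open>p\<close> is the total mass of \<open>N\<close>, whose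
    finiteness makes \<open>p\<close> integrable.\<close>
  have "(\<integral>\<^sup>+x. ennreal (p x) \<partial>M) = emeasure N (space M)"
    unfolding N using p by (simp add: emeasure_density cong: nn_integral_cong)
  also have "\<dots> < \<infinity>"
    using finite_measure.emeasure_finite[OF assms(1)] by (simp add: less_top)
  finally have "integrable M p"
    using p by (intro integrableI_nonneg) auto
  with p N show ?thesis using that by blast
qed

lemma integrable_mult_bounded:
  fixes w f :: "'a \<Rightarrow> complex"
  assumes w: "integrable M w" and f: "f \<in> borel_measurable M" and C: "\<And>x. norm (f x) \<le> C"
  shows "integrable M (\<lambda>x. w x * f x)"
proof (rule Bochner_Integration.integrable_bound)
  show "integrable M (\<lambda>x. norm (w x) * C)" using w by simp
  show "AE x in M. norm (w x * f x) \<le> norm (norm (w x) * C)"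
  proof (rule AE_I2)
    fix x
    show "norm (w x * f x) \<le> norm (norm (w x) * C)"
      using mult_left_mono[OF C[of x] norm_ge_zero[of "w x"]] by (simp add: norm_mult)
  qed
qed (use w f in measurable)

text \<open>A common dominating measure lets the four Radon--Nikodym derivatives combine into one
  complex density, so a single integral replaces four. \<open>M\<close> is built from
  \<open>\<mu>\<close> and is not arc length.\<close>

lemma complex_measure_density:
  fixes \<mu> :: "'a::topological_space set \<Rightarrow> complex"
  assumes "complex_borel_measure \<mu>"
  obtains M :: "'a measure" and \<rho> :: "'a \<Rightarrow> complex"
  where "finite_measure M" "sets M = sets borel" "integrable M \<rho>"
    "\<And>f. f \<in> borel_measurable borel \<Longrightarrow> bounded (range f) \<Longrightarrow>
      complex_measure_integral \<mu> f = (\<integral>x. \<rho> x * f x \<partial>M)"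
    "\<And>A. A \<in> sets borel \<Longrightarrow> \<mu> A = (\<integral>x. \<rho> x * indicator A x \<partial>M)"
proof -
  interpret R: signed_borel_measure "\<lambda>A. Re (\<mu> A)"
    using assms by unfold_locales (auto simp: complex_borel_measure_def intro: sums_Re)
  interpret R': signed_borel_measure "\<lambda>A. - Re (\<mu> A)" by (rule R.uminus)
  interpret I: signed_borel_measure "\<lambda>A. Im (\<mu> A)"
    using assms by unfold_locales (auto simp: complex_borel_measure_def intro: sums_Im)
  interpret I': signed_borel_measure "\<lambda>A. - Im (\<mu> A)" by (rule I.uminus)
  define N1 where "N1 = upper_variation (\<lambda>A. Re (\<mu> A))"
  define N2 where "N2 = upper_variation (\<lambda>A. - Re (\<mu> A))"
  define N3 where "N3 = upper_variation (\<lambda>A. Im (\<mu> A))"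
  define N4 where "N4 = upper_variation (\<lambda>A. - Im (\<mu> A))"
  note N_defs = N1_def N2_def N3_def N4_def
  have sets: "sets N1 = sets borel" "sets N2 = sets borel" "sets N3 = sets borel" "sets N4 = sets borel"
    by (simp_all add: N_defs)
  interpret N1: finite_measure N1 unfolding N_defs by (rule R.finite_measure_upper_variation)
  interpret N2: finite_measure N2 unfolding N_defs by (rule R'.finite_measure_upper_variation)
  interpret N3: finite_measure N3 unfolding N_defs by (rule I.finite_measure_upper_variation)
  interpret N4: finite_measure N4 unfolding N_defs by (rule I'.finite_measure_upper_variation)
  \<comment> \<open>The upper variation of the sum serves as a finite measure dominating all four.\<close>
  define S where "S A = measure N1 A + measure N2 A + measure N3 A + measure N4 A" for A
  interpret S: signed_borel_measure S
  proof
    fix A :: "nat \<Rightarrow> 'a set" assume A: "range A \<subseteq> sets borel" "disjoint_family A"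
    then show "(\<lambda>n. S (A n)) sums S (\<Union>n. A n)"
      unfolding S_def
      by (intro sums_add N1.finite_measure_UNION N2.finite_measure_UNION
          N3.finite_measure_UNION N4.finite_measure_UNION) (simp_all add: sets)
  qed (simp add: S_def)
  define M where "M = upper_variation S"
  have sets_M: "sets M = sets borel" by (simp add: M_def)
  interpret M: finite_measure M unfolding M_def by (rule S.finite_measure_upper_variation)
  \<comment> \<open>A set competes in its own supremum, so \<open>M\<close> is at least
    \<open>S\<close>, and an \<open>M\<close>-null set is null for everything below
    \<open>S\<close>.\<close>
  have ac: "absolutely_continuous M N"
    if N: "finite_measure N" "sets N = sets borel" "\<And>A. measure N A \<le> S A" for N
    unfolding absolutely_continuous_def
  proof
    fix A assume A: "A \<in> null_sets M"
    then have Ab: "A \<in> sets borel" using sets_M by auto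
    have "ennreal (S A) \<le> S.pos A" using Ab by (intro S.pos_upper) auto
    also have "\<dots> = 0"
      using A Ab by (auto simp: M_def S.emeasure_upper_variation)
    finally have "S A \<le> 0" by (simp add: ennreal_eq_0_iff)
    then have "measure N A = 0" using N(3)[of A] measure_nonneg[of N A] by linarith
    then show "A \<in> null_sets N"
      using N(1,2) Ab by (auto simp: finite_measure.emeasure_eq_measure)
  qed
  have leS: "measure N1 A \<le> S A" "measure N2 A \<le> S A" "measure N3 A \<le> S A" "measure N4 A \<le> S A" for A
    by (simp_all add: S_def)
  obtain p1 :: "'a \<Rightarrow> real" where p1: "p1 \<in> borel_measurable M" "\<And>x. 0 \<le> p1 x" "N1 = density M p1" "integrable M p1"
    using M.real_density[OF N1.finite_measure_axioms ac] sets sets_M leS N1.finite_measure_axioms by metis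
  obtain p2 :: "'a \<Rightarrow> real" where p2: "p2 \<in> borel_measurable M" "\<And>x. 0 \<le> p2 x" "N2 = density M p2" "integrable M p2"
    using M.real_density[OF N2.finite_measure_axioms ac] sets sets_M leS N2.finite_measure_axioms by metis
  obtain p3 :: "'a \<Rightarrow> real" where p3: "p3 \<in> borel_measurable M" "\<And>x. 0 \<le> p3 x" "N3 = density M p3" "integrable M p3"
    using M.real_density[OF N3.finite_measure_axioms ac] sets sets_M leS N3.finite_measure_axioms by metis
  obtain p4 :: "'a \<Rightarrow> real" where p4: "p4 \<in> borel_measurable M" "\<And>x. 0 \<le> p4 x" "N4 = density M p4" "integrable M p4"
    using M.real_density[OF N4.finite_measure_axioms ac] sets sets_M leS N4.finite_measure_axioms by metis
  define \<rho> where "\<rho> x = (complex_of_real (p1 x) - of_real (p2 x)) + \<i> * (of_real (p3 x) - of_real (p4 x))" for x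
  have int_\<rho>: "integrable M \<rho>"
    unfolding \<rho>_def
    by (intro Bochner_Integration.integrable_add Bochner_Integration.integrable_diff integrable_mult_right integrable_of_real p1 p2 p3 p4)
  have I: "complex_measure_integral \<mu> f = (\<integral>x. \<rho> x * f x \<partial>M)"
    if f: "f \<in> borel_measurable borel" and bd: "bounded (range f)" for f
  proof -
    obtain C where C: "\<And>x. norm (f x) \<le> C" using bd by (auto simp: bounded_iff)
    have fM: "f \<in> borel_measurable M" using f measurable_cong_sets[OF sets_M refl] by blast
    have int: "integrable M (\<lambda>x. complex_of_real (p x) * f x)"
      and eq: "integral\<^sup>L (density M p) f = (\<integral>x. complex_of_real (p x) * f x \<partial>M)"
      if p: "p \<in> borel_measurable M" "\<And>x. 0 \<le> p x" "integrable M p" for p :: "'a \<Rightarrow> real"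
    proof -
      show "integrable M (\<lambda>x. complex_of_real (p x) * f x)"
        using integrable_mult_bounded[OF integrable_of_real[OF p(3)] fM C] .
      show "integral\<^sup>L (density M p) f = (\<integral>x. complex_of_real (p x) * f x \<partial>M)"
        using p fM by (subst integral_density) (auto simp: scaleR_conv_of_real)
    qed
    note ints = int[OF p1(1,2,4)] int[OF p2(1,2,4)] int[OF p3(1,2,4)] int[OF p4(1,2,4)]
    have "complex_measure_integral \<mu> f = (integral\<^sup>L N1 f - integral\<^sup>L N2 f) + \<i> * (integral\<^sup>L N3 f - integral\<^sup>L N4 f)"
      by (simp add: complex_measure_integral_def N_defs)
    also have "\<dots> = (\<integral>x. (complex_of_real (p1 x) * f x - complex_of_real (p2 x) * f x) +
        \<i> * (complex_of_real (p3 x) * f x - complex_of_real (p4 x) * f x) \<partial>M)"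
      using p1 p2 p3 p4 ints by (simp add: eq)
    also have "\<dots> = (\<integral>x. \<rho> x * f x \<partial>M)"
      by (intro Bochner_Integration.integral_cong) (auto simp: \<rho>_def algebra_simps)
    finally show ?thesis .
  qed
  have ind: "integral\<^sup>L N (indicator A) = complex_of_real (measure N A)"
    if "sets N = sets borel" "A \<in> sets borel" for N :: "'a measure" and A
  proof -
    have "integral\<^sup>L N (indicator A) = (\<integral>x. complex_of_real (indicator A x) \<partial>N)"
      by (intro Bochner_Integration.integral_cong) (auto simp: indicator_def)
    also have "\<dots> = complex_of_real (measure N A)"
      using that sets.sets_into_space[of A N] by (simp add: Int_absorb2)
    finally show ?thesis .
  qed
  have "\<mu> A = (\<integral>x. \<rho> x * indicator A x \<partial>M)" if A: "A \<in> sets borel" for A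
  proof -
    have "complex_measure_integral \<mu> (indicator A) =
        (complex_of_real (measure N1 A) - measure N2 A) + \<i> * (complex_of_real (measure N3 A) - measure N4 A)"
      using A by (simp add: complex_measure_integral_def ind sets flip: N_defs)
    also have "\<dots> = \<mu> A"
      using R.Jordan_decomposition[OF A] I.Jordan_decomposition[OF A]
      by (simp add: complex_eq_iff N_defs)
    finally show ?thesis
      using A by (subst (asm) I) (auto simp: bounded_iff indicator_def intro!: exI[of _ 1])
  qed
  then show ?thesis
    using that M.finite_measure_axioms sets_M int_\<rho> I by blast
qed

subsection \<open>Uniqueness for characteristic functions\<close>

text \<open>The images under \<open>\<phi>\<close> of \<open>p dM\<close> and \<open>q dM\<close>,
  divided by their common mass \<open>m\<close>, are probability distributions with equal
  characteristic functions, hence equal by Levy's theorem. The masses agree by \<open>t = 0\<close>;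
  if \<open>m = 0\<close>, both densities vanish almost everywhere.\<close>

lemma (in finite_measure) nonneg_densities_eq_of_char_eq:
  fixes p q \<phi> :: "'a \<Rightarrow> real" and g :: "real \<Rightarrow> complex"
  assumes p: "integrable M p" "\<And>x. 0 \<le> p x" and q: "integrable M q" "\<And>x. 0 \<le> q x"
    and [measurable]: "\<phi> \<in> borel_measurable M" "g \<in> borel_measurable borel"
    and eq: "\<And>t. (\<integral>x. p x * iexp (t * \<phi> x) \<partial>M) = (\<integral>x. q x * iexp (t * \<phi> x) \<partial>M)"
  shows "(\<integral>x. p x * g (\<phi> x) \<partial>M) = (\<integral>x. q x * g (\<phi> x) \<partial>M)"
proof -
  define m where "m = (\<integral>x. p x \<partial>M)"
  have mq: "m = (\<integral>x. q x \<partial>M)"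
    using eq[of 0] by (simp add: m_def)
  have m0: "0 \<le> m" using p by (simp add: m_def)
  show ?thesis
  proof (cases "m = 0")
    case True
    then have "integral\<^sup>L M p = 0" "integral\<^sup>L M q = 0"
      using mq by (simp_all add: m_def)
    then have "AE x in M. p x = 0" "AE x in M. q x = 0"
      using p q by (simp_all add: integral_nonneg_eq_0_iff_AE)
    then show ?thesis by (intro integral_cong_AE) (use p q in auto)
  next
    case False
    define D where "D r = distr (density M (\<lambda>x. r x / m)) borel \<phi>" for r :: "'a \<Rightarrow> real"
    have int: "integral\<^sup>L (D r) h = (\<integral>x. r x * h (\<phi> x) \<partial>M) / m"
      if r: "integrable M r" "\<And>x. 0 \<le> r x" and [measurable]: "h \<in> borel_measurable borel"
      for r :: "'a \<Rightarrow> real" and h :: "real \<Rightarrow> complex"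
    proof -
      have [measurable]: "r \<in> borel_measurable M" using r by auto
      have "integral\<^sup>L (D r) h = (\<integral>x. (r x / m) *\<^sub>R h (\<phi> x) \<partial>M)"
        unfolding D_def using r m0 by (subst integral_distr) (auto simp: integral_density)
      also have "\<dots> = (\<integral>x. (r x * h (\<phi> x)) / m \<partial>M)"
        by (simp add: scaleR_conv_of_real)
      finally show ?thesis by simp
    qed
    have rd: "real_distribution (D r)"
      if r: "integrable M r" "\<And>x. 0 \<le> r x" "integral\<^sup>L M r = m" for r :: "'a \<Rightarrow> real"
    proof -
      have [measurable]: "r \<in> borel_measurable M" using r by auto
      have "emeasure (density M (\<lambda>x. r x / m)) (space M) = (\<integral>\<^sup>+x. ennreal (r x / m) \<partial>M)"
        by (simp add: emeasure_density cong: nn_integral_cong)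
      also have "\<dots> = ennreal (\<integral>x. r x / m \<partial>M)"
        using r m0 by (intro nn_integral_eq_integral) auto
      also have "\<dots> = 1" using r False by simp
      finally have "prob_space (density M (\<lambda>x. r x / m))"
        by (intro prob_spaceI) simp
      then show ?thesis
        unfolding real_distribution_def real_distribution_axioms_def D_def
        by (auto intro!: prob_space.prob_space_distr)
    qed
    have "char (D p) t = char (D q) t" for t
      unfolding char_def using p q eq[of t] by (simp add: int)
    then have "D p = D q"
      using p q mq by (intro Levy_uniqueness rd) (auto simp: m_def)
    then have "integral\<^sup>L (D p) g = integral\<^sup>L (D q) g" by simp
    then show ?thesis using False p q by (simp add: int)
  qed
qed

text \<open>Reduces to nonnegative densities: \<open>w\<close> is split into real and imaginary
  parts, and each of these into positive and negative parts, whose transforms then coincide. The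
  bound on \<open>g\<close> keeps all the split integrals finite.\<close>

lemma (in finite_measure) integral_eq_0_of_char_eq_0:
  fixes w :: "'a \<Rightarrow> complex" and \<phi> :: "'a \<Rightarrow> real" and g :: "real \<Rightarrow> complex"
  assumes w: "integrable M w"
    and \<phi>[measurable]: "\<phi> \<in> borel_measurable M" and g[measurable]: "g \<in> borel_measurable borel"
    and bd: "\<And>x. norm (g x) \<le> C"
    and eq: "\<And>t. (\<integral>x. w x * iexp (t * \<phi> x) \<partial>M) = 0"
  shows "(\<integral>x. w x * g (\<phi> x) \<partial>M) = 0"
proof -
  have int: "integrable M (\<lambda>x. v x * h (\<phi> x))"
    if v: "integrable M v" and [measurable]: "h \<in> borel_measurable borel" and "\<And>x. norm (h x) \<le> B"
    for v :: "'a \<Rightarrow> complex" and h :: "real \<Rightarrow> complex" and B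
    using that by (intro integrable_mult_bounded[OF v]) auto
  have real_case: "(\<integral>x. complex_of_real (u x) * g (\<phi> x) \<partial>M) = 0"
    if u: "integrable M u" and u0: "\<And>t. (\<integral>x. complex_of_real (u x) * iexp (t * \<phi> x) \<partial>M) = 0"
    for u :: "'a \<Rightarrow> real"
  proof -
    define p q where "p x = max 0 (u x)" and "q x = max 0 (- u x)" for x
    have pq: "integrable M p" "integrable M q" "\<And>x. 0 \<le> p x" "\<And>x. 0 \<le> q x"
      unfolding p_def q_def using u by auto
    have upq: "u x = p x - q x" for x by (auto simp: p_def q_def)
    have split: "(\<integral>x. complex_of_real (u x) * h (\<phi> x) \<partial>M) =
        (\<integral>x. p x * h (\<phi> x) \<partial>M) - (\<integral>x. q x * h (\<phi> x) \<partial>M)"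
      if [measurable]: "h \<in> borel_measurable borel" and "\<And>x. norm (h x) \<le> B"
      for h :: "real \<Rightarrow> complex" and B
      unfolding upq of_real_diff left_diff_distrib
      using int[OF integrable_of_real[OF pq(1)] that] int[OF integrable_of_real[OF pq(2)] that]
      by (rule Bochner_Integration.integral_diff)
    have "(\<integral>x. p x * iexp (t * \<phi> x) \<partial>M) = (\<integral>x. q x * iexp (t * \<phi> x) \<partial>M)" for t
      using split[of "\<lambda>y. iexp (t * y)" 1] u0[of t] by simp
    then have "(\<integral>x. p x * g (\<phi> x) \<partial>M) = (\<integral>x. q x * g (\<phi> x) \<partial>M)"
      by (rule nonneg_densities_eq_of_char_eq[OF pq(1,3) pq(2,4) \<phi> g])
    then show ?thesis using split[OF g bd] by simp
  qed
  have e_meas: "(\<lambda>y. iexp (t * y)) \<in> borel_measurable borel" for t :: real by measurable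
  have ints: "integrable M (\<lambda>x. w x * iexp (t * \<phi> x))" "integrable M (\<lambda>x. cnj (w x) * iexp (t * \<phi> x))" for t
    by (intro int[OF _ e_meas, where B = 1] integrable_cnj w; simp)+
  \<comment> \<open>Conjugation exchanges the frequencies \<open>t\<close> and \<open>- t\<close>.
    With the transforms of \<open>w\<close> and \<open>cnj w\<close> both zero, those of the real
    and imaginary parts vanish too.\<close>
  have cnj0: "(\<integral>x. cnj (w x) * iexp (t * \<phi> x) \<partial>M) = 0" for t
  proof -
    have "cnj (\<integral>x. w x * iexp (- t * \<phi> x) \<partial>M) = (\<integral>x. cnj (w x * iexp (- t * \<phi> x)) \<partial>M)"
      by (rule Bochner_Integration.integral_cnj[symmetric])
    also have "\<dots> = (\<integral>x. cnj (w x) * iexp (t * \<phi> x) \<partial>M)"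
      by (simp add: exp_cnj)
    finally show ?thesis using eq[of "- t"] by simp
  qed
  have "(\<integral>x. complex_of_real (Re (w x)) * iexp (t * \<phi> x) \<partial>M) = 0" for t
  proof -
    have "(\<integral>x. complex_of_real (Re (w x)) * iexp (t * \<phi> x) \<partial>M) =
        (\<integral>x. (w x * iexp (t * \<phi> x) + cnj (w x) * iexp (t * \<phi> x)) / 2 \<partial>M)"
      by (intro Bochner_Integration.integral_cong refl)
        (simp add: complex_add_cnj flip: distrib_right)
    also have "\<dots> = 0" using ints[of t] eq[of t] cnj0[of t] by simp
    finally show ?thesis .
  qed
  moreover have "(\<integral>x. complex_of_real (Im (w x)) * iexp (t * \<phi> x) \<partial>M) = 0" for t
  proof -
    have "(\<integral>x. complex_of_real (Im (w x)) * iexp (t * \<phi> x) \<partial>M) =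
        (\<integral>x. (w x * iexp (t * \<phi> x) - cnj (w x) * iexp (t * \<phi> x)) / (2 * \<i>) \<partial>M)"
      by (intro Bochner_Integration.integral_cong refl)
        (simp add: complex_eq_iff)
    also have "\<dots> = 0" using ints[of t] eq[of t] cnj0[of t] by simp
    finally show ?thesis .
  qed
  ultimately have 0: "(\<integral>x. complex_of_real (Re (w x)) * g (\<phi> x) \<partial>M) = 0"
    "(\<integral>x. complex_of_real (Im (w x)) * g (\<phi> x) \<partial>M) = 0"
    using w by (auto intro!: real_case)
  have "(\<integral>x. w x * g (\<phi> x) \<partial>M) =
      (\<integral>x. complex_of_real (Re (w x)) * g (\<phi> x) + \<i> * (complex_of_real (Im (w x)) * g (\<phi> x)) \<partial>M)"
    by (intro Bochner_Integration.integral_cong refl) (simp add: complex_eq_iff algebra_simps)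
  also have "\<dots> = 0"
    using 0 int[of "\<lambda>x. of_real (Re (w x))" g C] int[of "\<lambda>x. of_real (Im (w x))" g C] w bd g
    by (simp add: integrable_Re integrable_Im)
  finally show ?thesis .
qed

subsection \<open>Arc length and densities\<close>

text \<open>Injectivity makes the preimage of a countable set countable, hence
  Lebesgue-null.\<close>

lemma emeasure_param_arc_length_countable:
  assumes "inj_on \<gamma> I" "countable C"
  shows "emeasure (param_arc_length I \<gamma>) C = 0"
proof -
  let ?R = "restrict_space lborel I"
  let ?D = "density ?R (\<lambda>t. ennreal (norm (vector_derivative \<gamma> (at t within I))))"
  \<comment> \<open>\<open>emeasure_measure_of_conv\<close> bypasses the measurability of \<open>I\<close>, \<open>\<gamma>\<close> and \<open>\<gamma>'\<close>: where it fails, \<open>emeasure\<close> is \<open>0\<close>.\<close>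
  define N where "N = \<gamma> -` C \<inter> I"
  have "countable N"
    using countable_image_inj_Int_vimage[OF assms] by (simp add: N_def Int_commute)
  then have N: "N \<in> null_sets lborel" by (rule countable_imp_null_set_lborel)
  have "N = I \<inter> N" by (auto simp: N_def)
  then have "N \<in> sets ?R"
    unfolding sets_restrict_space using N by blast
  moreover have "emeasure ?R N = 0"
    using null_setsD1[OF N] by (simp add: restrict_space_def emeasure_measure_of_conv)
  ultimately have "N \<in> null_sets ?R" by auto
  then have "AE t in ?R. f t * indicator N t = (0::ennreal)" for f
    by (rule AE_I') (auto simp: indicator_def)
  then have "(\<integral>\<^sup>+t. f t * indicator N t \<partial>?R) = 0" for f :: "real \<Rightarrow> ennreal"
    using nn_integral_cong_AE[of "\<lambda>t. f t * indicator N t" "\<lambda>_. 0" ?R] by simp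
  then have "emeasure ?D N = 0"
    by (simp add: density_def emeasure_measure_of_conv)
  moreover have "\<gamma> -` C \<inter> space ?D = N"
    by (auto simp: N_def space_restrict_space)
  ultimately show ?thesis
    by (simp add: param_arc_length_def distr_def emeasure_measure_of_conv)
qed

text \<open>Stated for every admissible \<open>M\<close>, because \<open>X_space\<close> only
  asserts that some arc length measure exists.\<close>

lemma null_sets_arc_length_countable:
  assumes "is_arc_length_measure \<Gamma> M" "countable C"
  shows "C \<in> null_sets M"
proof -
  obtain n :: nat and I \<gamma> where *:
    "\<forall>k<n. smooth_curve_param (I k) (\<gamma> k)" "sets M = sets borel"
    "\<forall>A\<in>sets borel. emeasure M A = (\<Sum>k<n. emeasure (param_arc_length (I k) (\<gamma> k)) A)"
    using assms(1) unfolding is_arc_length_measure_def by metis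
  have C: "C \<in> sets borel"
    using assms(2) by (rule sets.countable[rotated]) auto
  have "emeasure (param_arc_length (I k) (\<gamma> k)) C = 0" if "k < n" for k
    using *(1) that assms(2) by (intro emeasure_param_arc_length_countable) (auto simp: smooth_curve_param_def)
  then show ?thesis
    using *(2,3) C by auto
qed

section \<open>Smoothness of the graph of \<open>exp (t\<^sup>2)\<close>\<close>

primrec gauss_poly :: "nat \<Rightarrow> real poly" where
  "gauss_poly 0 = 1"
| "gauss_poly (Suc n) = pderiv (gauss_poly n) + [:0, 2:] * gauss_poly n"

text \<open>Supplies the sequence \<open>D\<close> of \<open>smooth_on_interval\<close>. The
  coordinate \<open>t\<close> is written as the polynomial \<open>[:0, 1:]\<close> to have one
  formula for all orders. In terms of Hermite polynomials, \<open>gauss_poly n\<close> at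
  \<open>t\<close> is \<open>(-i)^n H_n(i t)\<close>.\<close>

lemma has_vector_derivative_gauss_poly:
  "((\<lambda>t. (poly ((pderiv ^^ n) [:0, 1:]) t, poly (gauss_poly n) t * exp (t\<^sup>2))) has_vector_derivative
    (poly ((pderiv ^^ Suc n) [:0, 1:]) t, poly (gauss_poly (Suc n)) t * exp (t\<^sup>2))) (at t within S)"
proof -
  have 1: "((\<lambda>t. poly ((pderiv ^^ n) [:0, 1:]) t) has_vector_derivative
      poly ((pderiv ^^ Suc n) [:0, 1::real:]) t) (at t within S)"
    unfolding has_real_derivative_iff_has_vector_derivative[symmetric]
    by (auto intro!: derivative_eq_intros poly_DERIV[THEN DERIV_subset])
  have 2: "((\<lambda>t. poly (gauss_poly n) t * exp (t\<^sup>2)) has_vector_derivative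
      poly (gauss_poly (Suc n)) t * exp (t\<^sup>2)) (at t within S)"
    unfolding has_real_derivative_iff_has_vector_derivative[symmetric]
    by (auto intro!: derivative_eq_intros poly_DERIV[THEN DERIV_subset] simp: algebra_simps)
  show ?thesis
    using has_derivative_Pair[OF 1[unfolded has_vector_derivative_def] 2[unfolded has_vector_derivative_def]]
    by (simp add: has_vector_derivative_def)
qed

text \<open>One global parametrization suffices; its first coordinate \<open>t\<close> makes it
  injective and regular.\<close>

lemma smooth_curve_gauss_graph: "smooth_curve {(t, exp (t\<^sup>2)) | t::real. True}"
proof -
  define \<gamma> :: "real \<Rightarrow> real \<times> real" where "\<gamma> = (\<lambda>t. (t, exp (t\<^sup>2)))"
  have deriv: "(\<gamma> has_vector_derivative (1, 2 * t * exp (t\<^sup>2))) (at t)" for t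
    using has_vector_derivative_gauss_poly[of 0 t UNIV] by (simp add: \<gamma>_def pderiv_pCons mult.commute)
  have "smooth_on_interval UNIV \<gamma>"
    unfolding smooth_on_interval_def
    by (rule exI[of _ "\<lambda>n t. (poly ((pderiv ^^ n) [:0, 1:]) t, poly (gauss_poly n) t * exp (t\<^sup>2))"])
      (use has_vector_derivative_gauss_poly in \<open>auto simp: \<gamma>_def simp del: funpow.simps gauss_poly.simps(2)\<close>)
  moreover have "vector_derivative \<gamma> (at t) \<noteq> 0" for t
    using vector_derivative_at[OF deriv[of t]] by (simp add: zero_prod_def)
  moreover have "inj \<gamma>" by (auto simp: inj_on_def \<gamma>_def)
  ultimately have "smooth_curve_param UNIV \<gamma>"
    by (simp add: smooth_curve_param_def)
  then have "is_arc_length_measure (range \<gamma>) (param_arc_length UNIV \<gamma>)"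
    unfolding is_arc_length_measure_def
    by (intro exI[of _ 1] exI[of _ "\<lambda>_. UNIV"] exI[of _ "\<lambda>_. \<gamma>"])
      (auto simp: param_arc_length_def disjoint_family_on_def)
  moreover have "range \<gamma> = {(t, exp (t\<^sup>2)) | t::real. True}" by (auto simp: \<gamma>_def)
  ultimately show ?thesis unfolding smooth_curve_def by metis
qed

section \<open>Reduction of the uniqueness property to densities\<close>

lemma integrable_mult_indicator_complex:
  fixes \<rho> :: "'a \<Rightarrow> complex"
  assumes "integrable M \<rho>" "A \<in> sets M"
  shows "integrable M (\<lambda>x. \<rho> x * indicator A x)"
  using assms by (intro integrable_mult_bounded[where C = 1]) (auto simp: indicator_def)

lemma (in sigma_finite_measure) AE_eq_0_on:
  fixes \<rho> :: "'a \<Rightarrow> complex"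
  assumes \<rho>: "integrable M \<rho>" and T: "T \<in> sets M"
    and 0: "\<And>A. A \<in> sets M \<Longrightarrow> A \<subseteq> T \<Longrightarrow> (\<integral>x. \<rho> x * indicator A x \<partial>M) = 0"
  shows "AE x in M. x \<in> T \<longrightarrow> \<rho> x = 0"
proof -
  have "AE x in M. \<rho> x * indicator T x = 0"
  proof (rule density_zero)
    show "integrable M (\<lambda>x. \<rho> x * indicator T x)"
      using \<rho> T by (rule integrable_mult_indicator_complex)
    fix A assume A: "A \<in> sets M"
    have "set_lebesgue_integral M A (\<lambda>x. \<rho> x * indicator T x) = (\<integral>x. \<rho> x * indicator (A \<inter> T) x \<partial>M)"
      unfolding set_lebesgue_integral_def
      by (intro Bochner_Integration.integral_cong) (auto simp: indicator_def)
    also have "\<dots> = 0" using A T by (intro 0) auto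
    finally show "set_lebesgue_integral M A (\<lambda>x. \<rho> x * indicator T x) = 0" .
  qed
  then show ?thesis by eventually_elim (auto simp: indicator_def)
qed

text \<open>The last premise of \<open>zero\<close> is the form in which the curve enters: with
  \<open>T\<close> the complement of \<open>\<Gamma>\<close>, if Borel, it expresses the support
  condition, and with \<open>T\<close> countable it expresses the part of absolute continuity used
  here.\<close>

lemma heisenberg_uniqueness_pair_densityI:
  assumes "smooth_curve \<Gamma>"
    and zero: "\<And>M \<rho>. \<lbrakk>finite_measure M; sets M = sets borel; integrable M \<rho>;
      \<And>\<xi> \<eta>. (\<xi>, \<eta>) \<in> \<Lambda> \<Longrightarrow>
        (\<integral>p. \<rho> p * (cis (- pi * \<xi> * fst p) * cis (- pi * \<eta> * snd p)) \<partial>M) = 0;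
      \<And>T. \<lbrakk>T \<in> sets borel; countable (T \<inter> \<Gamma>)\<rbrakk> \<Longrightarrow> AE p in M. p \<in> T \<longrightarrow> \<rho> p = 0\<rbrakk> \<Longrightarrow>
      AE p in M. \<rho> p = 0"
  shows "heisenberg_uniqueness_pair \<Gamma> \<Lambda>"
  unfolding heisenberg_uniqueness_pair_def
proof (intro conjI ballI impI)
  fix \<mu> and S :: "(real \<times> real) set"
  assume X: "\<mu> \<in> X_space \<Gamma>" and \<mu>0: "\<forall>p\<in>\<Lambda>. fourier_transform \<mu> p = 0" and S: "S \<in> sets borel"
  obtain L where \<mu>: "complex_borel_measure \<mu>"
    and supp: "\<And>A. A \<in> sets borel \<Longrightarrow> A \<inter> \<Gamma> = {} \<Longrightarrow> \<mu> A = 0"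
    and L: "is_arc_length_measure \<Gamma> L" "\<And>A. A \<in> null_sets L \<Longrightarrow> \<mu> A = 0"
    using X unfolding X_space_def by blast
  obtain M \<rho> where M: "finite_measure M" "sets M = sets borel" "integrable M \<rho>"
    and I: "\<And>f. f \<in> borel_measurable borel \<Longrightarrow> bounded (range f) \<Longrightarrow>
      complex_measure_integral \<mu> f = (\<integral>p. \<rho> p * f p \<partial>M)"
    and A: "\<And>A. A \<in> sets borel \<Longrightarrow> \<mu> A = (\<integral>p. \<rho> p * indicator A p \<partial>M)"
    using complex_measure_density[OF \<mu>] by blast
  interpret finite_measure M by fact
  have F: "fourier_transform \<mu> (\<xi>, \<eta>) = (\<integral>p. \<rho> p * (cis (- pi * \<xi> * fst p) * cis (- pi * \<eta> * snd p)) \<partial>M)" for \<xi> \<eta>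
  proof -
    have "(\<lambda>(x, y). exp (- \<i> * complex_of_real pi * complex_of_real (x * \<xi> + y * \<eta>))) =
        (\<lambda>p. cis (- pi * \<xi> * fst p) * cis (- pi * \<eta> * snd p))"
      unfolding cis_mult unfolding cis_conv_exp split_beta
      by (rule ext, rule arg_cong[where f = exp]) (simp add: algebra_simps)
    then have "fourier_transform \<mu> (\<xi>, \<eta>) =
        complex_measure_integral \<mu> (\<lambda>p. cis (- pi * \<xi> * fst p) * cis (- pi * \<eta> * snd p))"
      by (simp add: fourier_transform_def)
    also have "\<dots> = (\<integral>p. \<rho> p * (cis (- pi * \<xi> * fst p) * cis (- pi * \<eta> * snd p)) \<partial>M)"
      by (rule I)
        (auto simp: norm_mult bounded_iff intro!: exI[of _ 1] borel_measurable_continuous_onI continuous_intros)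
    finally show ?thesis .
  qed
  \<comment> \<open>Each \<open>B \<subseteq> T\<close> splits into a part on
    \<open>\<Gamma>\<close>, null for arc length, and a part off \<open>\<Gamma>\<close>.
    Countability of the first makes both Borel.\<close>
  have null: "AE p in M. p \<in> T \<longrightarrow> \<rho> p = 0" if T: "T \<in> sets borel" "countable (T \<inter> \<Gamma>)" for T
  proof (rule AE_eq_0_on[OF M(3)])
    fix B assume B: "B \<in> sets M" "B \<subseteq> T"
    have cnt: "countable (B \<inter> \<Gamma>)"
      using T(2) by (rule countable_subset[rotated]) (use B in auto)
    then have Bb: "B \<inter> \<Gamma> \<in> sets borel" "B - B \<inter> \<Gamma> \<in> sets borel"
      using B M(2) sets.countable[of "B \<inter> \<Gamma>" borel] by auto
    have "(\<integral>p. \<rho> p * indicator B p \<partial>M) =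
        (\<integral>p. \<rho> p * indicator (B \<inter> \<Gamma>) p + \<rho> p * indicator (B - B \<inter> \<Gamma>) p \<partial>M)"
      by (intro Bochner_Integration.integral_cong) (auto simp: indicator_def)
    also have "\<dots> = \<mu> (B \<inter> \<Gamma>) + \<mu> (B - B \<inter> \<Gamma>)"
      using Bb M by (simp add: A integrable_mult_indicator_complex)
    also have "\<mu> (B \<inter> \<Gamma>) = 0"
      using null_sets_arc_length_countable[OF L(1) cnt] by (rule L(2))
    also have "\<mu> (B - B \<inter> \<Gamma>) = 0"
      using Bb by (intro supp) auto
    finally show "(\<integral>p. \<rho> p * indicator B p \<partial>M) = 0" by simp
  qed (use T M in auto)
  have "AE p in M. \<rho> p = 0"
  proof (rule zero[OF M _ null])
    show "(\<integral>p. \<rho> p * (cis (- pi * \<xi> * fst p) * cis (- pi * \<eta> * snd p)) \<partial>M) = 0"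
      if "(\<xi>, \<eta>) \<in> \<Lambda>" for \<xi> \<eta>
      using \<mu>0 that unfolding F[symmetric] by blast
  qed
  then have "AE p in M. \<rho> p * indicator S p = 0"
    by eventually_elim simp
  then show "\<mu> S = 0"
    unfolding A[OF S] by (rule integral_eq_zero_AE)
qed fact

subsection \<open>Lines parallel to the axes\<close>

definition gauss_graph :: "(real \<times> real) set" where
  "gauss_graph = {(t, exp (t\<^sup>2)) | t. True}"

lemma gauss_graph_iff: "p \<in> gauss_graph \<longleftrightarrow> snd p = exp ((fst p)\<^sup>2)"
  by (cases p) (auto simp: gauss_graph_def)

lemma borel_Compl_gauss_graph: "- gauss_graph \<in> sets borel"
proof -
  have "gauss_graph = {p. snd p = exp ((fst p)\<^sup>2)}" by (auto simp: gauss_graph_iff)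
  moreover have "closed {p :: real \<times> real. snd p = exp ((fst p)\<^sup>2)}"
    by (intro closed_Collect_eq continuous_intros)
  ultimately show ?thesis by simp
qed

lemma borel_measurable_fst_snd [measurable]:
  "fst \<in> borel_measurable (borel :: (real \<times> real) measure)"
  "snd \<in> borel_measurable (borel :: (real \<times> real) measure)"
  by (auto intro!: borel_measurable_continuous_onI continuous_intros)

lemma borel_measurable_cis [measurable]: "cis \<in> borel_measurable borel"
  by (auto intro!: borel_measurable_continuous_onI continuous_intros)

lemma heisenberg_uniqueness_pair_horizontal:
  "heisenberg_uniqueness_pair gauss_graph {(x, y). y = c}"
proof (rule heisenberg_uniqueness_pair_densityI)
  show "smooth_curve gauss_graph"
    unfolding gauss_graph_def by (rule smooth_curve_gauss_graph)
next
  fix M :: "(real \<times> real) measure" and \<rho>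
  assume M: "finite_measure M" "sets M = sets borel" "integrable M \<rho>"
    and F: "\<And>\<xi> \<eta>. (\<xi>, \<eta>) \<in> {(x, y). y = c} \<Longrightarrow>
      (\<integral>p. \<rho> p * (cis (- pi * \<xi> * fst p) * cis (- pi * \<eta> * snd p)) \<partial>M) = 0"
    and null: "\<And>T. T \<in> sets borel \<Longrightarrow> countable (T \<inter> gauss_graph) \<Longrightarrow> AE p in M. p \<in> T \<longrightarrow> \<rho> p = 0"
  interpret finite_measure M by fact
  note [measurable_cong] = M(2)
  have [measurable]: "\<rho> \<in> borel_measurable M" using M by auto
  have off: "AE p in M. p \<in> - gauss_graph \<longrightarrow> \<rho> p = 0"
    by (rule null[OF borel_Compl_gauss_graph]) simp
  define w where "w p = \<rho> p * cis (- pi * c * snd p)" for p :: "real \<times> real"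
  have [measurable]: "w \<in> borel_measurable M" unfolding w_def by measurable
  have w: "integrable M w"
    by (rule Bochner_Integration.integrable_bound[OF M(3)]) (auto simp: w_def norm_mult)
  have char0: "(\<integral>p. w p * iexp (t * fst p) \<partial>M) = 0" for t
  \<comment> \<open>The frequency \<open>\<xi> = - t / pi\<close> turns the kernel
    \<open>exp (- i pi \<xi> x)\<close> into \<open>iexp (t * x)\<close>.\<close>
  proof -
    have "(\<integral>p. w p * iexp (t * fst p) \<partial>M) =
        (\<integral>p. \<rho> p * (cis (- pi * (- t / pi) * fst p) * cis (- pi * c * snd p)) \<partial>M)"
      by (intro Bochner_Integration.integral_cong) (auto simp: w_def cis_conv_exp)
    then show ?thesis using F[of "- t / pi" c] by simp
  qed
  have "(\<integral>p. w p * indicator B p \<partial>M) = 0" if B[measurable]: "B \<in> sets borel" for B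
  proof -
    \<comment> \<open>On the graph, where \<open>\<rho>\<close> lives, the indicator of
      \<open>B\<close> depends on the first coordinate alone.\<close>
    define g where "g x = (indicator B (x, exp (x\<^sup>2)) :: complex)" for x :: real
    have [measurable]: "(\<lambda>x::real. (x, exp (x\<^sup>2))) \<in> borel_measurable borel"
      by (auto intro!: borel_measurable_continuous_onI continuous_intros)
    have [measurable]: "g \<in> borel_measurable borel"
      unfolding g_def by measurable
    have "(\<integral>p. w p * indicator B p \<partial>M) = (\<integral>p. w p * g (fst p) \<partial>M)"
    proof (rule integral_cong_AE)
      show "AE p in M. w p * indicator B p = w p * g (fst p)"
        using off by eventually_elim (auto simp: g_def w_def gauss_graph_iff)
    qed measurable
    also have "\<dots> = 0"
      by (rule integral_eq_0_of_char_eq_0[OF w _ _ _ char0, where C = 1])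
        (auto simp: g_def indicator_def)
    finally show ?thesis .
  qed
  then have "AE p in M. p \<in> UNIV \<longrightarrow> w p = 0"
    using M(2) by (intro AE_eq_0_on w) auto
  then show "AE p in M. \<rho> p = 0"
    by eventually_elim (simp add: w_def)
qed

lemma heisenberg_uniqueness_pair_vertical:
  assumes "a \<noteq> b"
  shows "heisenberg_uniqueness_pair gauss_graph ({(x, y). x = a} \<union> {(x, y). x = b})"
proof (rule heisenberg_uniqueness_pair_densityI)
  show "smooth_curve gauss_graph"
    unfolding gauss_graph_def by (rule smooth_curve_gauss_graph)
next
  fix M :: "(real \<times> real) measure" and \<rho>
  assume M: "finite_measure M" "sets M = sets borel" "integrable M \<rho>"
    and F: "\<And>\<xi> \<eta>. (\<xi>, \<eta>) \<in> {(x, y). x = a} \<union> {(x, y). x = b} \<Longrightarrow>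
      (\<integral>p. \<rho> p * (cis (- pi * \<xi> * fst p) * cis (- pi * \<eta> * snd p)) \<partial>M) = 0"
    and null: "\<And>T. T \<in> sets borel \<Longrightarrow> countable (T \<inter> gauss_graph) \<Longrightarrow> AE p in M. p \<in> T \<longrightarrow> \<rho> p = 0"
  interpret finite_measure M by fact
  note [measurable_cong] = M(2)
  have [measurable]: "\<rho> \<in> borel_measurable M" using M by auto
  have off: "AE p in M. p \<in> - gauss_graph \<longrightarrow> \<rho> p = 0"
    by (rule null[OF borel_Compl_gauss_graph]) simp
  define E where "E s x = cis (- pi * s * x)" for s x :: real
  have norm_E [simp]: "norm (E s x) = 1" for s x by (simp add: E_def)
  have E_meas [measurable]: "E s \<in> borel_measurable borel" for s
    unfolding E_def by measurable
  note int_bd = integrable_mult_bounded[OF M(3)]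
  have even: "(\<integral>p. \<rho> p * E s (fst p) * g (fst p) \<partial>M) = 0"
    if s: "s = a \<or> s = b" and g[measurable]: "g \<in> borel_measurable borel"
      and bd: "\<And>x. norm (g x) \<le> C" and even: "\<And>x. g (- x) = g x"
    for s C and g :: "real \<Rightarrow> complex"
  proof -
    \<comment> \<open>From \<open>y = exp (x\<^sup>2)\<close> this recovers
      \<open>\<bar>x\<bar>\<close>, and evenness of \<open>g\<close> absorbs the sign. The graph has
      \<open>y \<ge> 1\<close>; for other \<open>y\<close> the values of \<open>ln\<close> and
      \<open>sqrt\<close> are harmless since \<open>g\<close> is bounded everywhere.\<close>
    define G where "G y = g (sqrt (ln y))" for y
    have [measurable]: "G \<in> borel_measurable borel" unfolding G_def by measurable
    have w: "integrable M (\<lambda>p. \<rho> p * E s (fst p))"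
      by (rule int_bd[where C = 1]) auto
    have char0: "(\<integral>p. \<rho> p * E s (fst p) * iexp (t * snd p) \<partial>M) = 0" for t
    proof -
      have "(\<integral>p. \<rho> p * E s (fst p) * iexp (t * snd p) \<partial>M) =
          (\<integral>p. \<rho> p * (cis (- pi * s * fst p) * cis (- pi * (- t / pi) * snd p)) \<partial>M)"
        by (intro Bochner_Integration.integral_cong) (auto simp: E_def cis_conv_exp)
      then show ?thesis using F[of s "- t / pi"] s by auto
    qed
    have "G (exp (x\<^sup>2)) = g x" for x
      using even[of x] by (cases "0 \<le> x") (auto simp: G_def)
    then have "(\<integral>p. \<rho> p * E s (fst p) * g (fst p) \<partial>M) = (\<integral>p. \<rho> p * E s (fst p) * G (snd p) \<partial>M)"
      using off by (intro integral_cong_AE) (auto simp: gauss_graph_iff elim!: eventually_mono)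
    also have "\<dots> = 0"
      by (rule integral_eq_0_of_char_eq_0[OF w _ _ _ char0, where C = C])
        (auto simp: G_def bd)
    finally show ?thesis .
  qed

  \<comment> \<open>\<open>g1\<close> and \<open>g2\<close> below solve, by Cramer's rule, the linear system for the values at \<open>x\<close> and \<open>- x\<close>;
    multiplying the right-hand side by \<open>D\<^sup>2\<close> and not by \<open>D\<close> makes the solution even and avoids division.\<close>
  define D where "D x = E a x * E b (- x) - E a (- x) * E b x" for x
  have D_odd: "D (- x) = - D x" for x by (simp add: D_def)
  have D_meas [measurable]: "D \<in> borel_measurable borel" unfolding D_def by measurable
  have D_bd: "norm (D x) \<le> 2" for x
    unfolding D_def by (rule order_trans[OF norm_triangle_ineq4]) (simp add: norm_mult)

  have D0: "(\<integral>p. \<rho> p * (D (fst p))\<^sup>2 * indicator B p \<partial>M) = 0" if [measurable]: "B \<in> sets borel" for B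
  proof -
    define K where "K x = (indicator B (x, exp (x\<^sup>2)) :: complex)" for x :: real
    have K_bd: "norm (K x) \<le> 1" for x by (simp add: K_def indicator_def)
    have [measurable]: "(\<lambda>x::real. (x, exp (x\<^sup>2))) \<in> borel_measurable borel"
      by (auto intro!: borel_measurable_continuous_onI continuous_intros)
    have [measurable]: "K \<in> borel_measurable borel" unfolding K_def by measurable
    define g1 where "g1 x = D x * (K x * E b (- x) - K (- x) * E b x)" for x
    define g2 where "g2 x = D x * (E a x * K (- x) - E a (- x) * K x)" for x
    have [measurable]: "g1 \<in> borel_measurable borel" "g2 \<in> borel_measurable borel"
      unfolding g1_def g2_def by measurable
    have bd: "norm (g1 x) \<le> 2 * 2" "norm (g2 x) \<le> 2 * 2" for x
      unfolding g1_def g2_def norm_mult using K_bd[of x] K_bd[of "- x"]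
      by (intro mult_mono D_bd order_trans[OF norm_triangle_ineq4]; simp add: norm_mult)+
    have ev: "g1 (- x) = g1 x" "g2 (- x) = g2 x" for x
      by (simp_all add: g1_def g2_def D_odd algebra_simps)
    have Cramer: "K x * (D x)\<^sup>2 = E a x * g1 x + E b x * g2 x" for x
      by (simp add: g1_def g2_def D_def power2_eq_square algebra_simps)
    have "(\<integral>p. \<rho> p * (D (fst p))\<^sup>2 * indicator B p \<partial>M) = (\<integral>p. \<rho> p * (K (fst p) * (D (fst p))\<^sup>2) \<partial>M)"
      using off by (intro integral_cong_AE) (auto simp: gauss_graph_iff K_def elim!: eventually_mono)
    \<comment> \<open>The first term is annihilated by the data on the line \<open>x = a\<close>,
      the second by those on \<open>x = b\<close>.\<close>
    also have "\<dots> = (\<integral>p. \<rho> p * (E a (fst p) * g1 (fst p)) + \<rho> p * (E b (fst p) * g2 (fst p)) \<partial>M)"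
      by (simp add: Cramer distrib_left)
    also have "\<dots> = (\<integral>p. \<rho> p * (E a (fst p) * g1 (fst p)) \<partial>M) + (\<integral>p. \<rho> p * (E b (fst p) * g2 (fst p)) \<partial>M)"
      by (intro Bochner_Integration.integral_add int_bd[where C = "2 * 2"])
        (use bd in \<open>auto simp: norm_mult\<close>)
    also have "\<dots> = 0"
      using even[of a g1, OF _ _ bd(1) ev(1)] even[of b g2, OF _ _ bd(2) ev(2)]
      by (simp add: mult.assoc)
    finally show ?thesis .
  qed
  have "integrable M (\<lambda>p. \<rho> p * (D (fst p))\<^sup>2)"
    by (rule int_bd[where C = "2\<^sup>2"])
      (use power_mono[OF D_bd norm_ge_zero, of _ 2] in \<open>auto simp: norm_power\<close>)
  then have "AE p in M. p \<in> UNIV \<longrightarrow> \<rho> p * (D (fst p))\<^sup>2 = 0"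
    using M(2) D0 by (intro AE_eq_0_on) auto
  \<comment> \<open>The zeros of \<open>D\<close> are multiples of \<open>1 / (b - a)\<close>. The
    set in the plane is a union of vertical lines, each meeting the graph in one point, so
    \<open>null\<close> applies.\<close>
  moreover have "AE p in M. p \<in> {p. D (fst p) = 0} \<longrightarrow> \<rho> p = 0"
  proof (rule null)
    have "D x = cis (pi * (b - a) * x) - cis (- (pi * (b - a) * x))" for x
      by (simp add: D_def E_def cis_mult algebra_simps)
    then have D_sin: "D x = 2 * \<i> * complex_of_real (sin (pi * (b - a) * x))" for x
      by (simp add: complex_eq_iff)
    have "x \<in> range (\<lambda>n::int. n / (b - a))" if "D x = 0" for x
    proof -
      have "sin (pi * (b - a) * x) = 0" using that unfolding D_sin by simp
      then obtain n :: int where "pi * (b - a) * x = n * pi" unfolding sin_zero_iff_int2 by blast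
      then have "(b - a) * x = n" by (simp add: mult.assoc mult.commute[of _ pi])
      then have "x = n / (b - a)" using assms by (simp add: eq_divide_eq mult.commute)
      then show ?thesis by blast
    qed
    then have "{p. D (fst p) = 0} \<inter> gauss_graph \<subseteq> (\<lambda>x. (x, exp (x\<^sup>2))) ` range (\<lambda>n::int. n / (b - a))"
      by (force simp: gauss_graph_def)
    then show "countable ({p. D (fst p) = 0} \<inter> gauss_graph)"
      by (rule countable_subset) auto
    show "{p :: real \<times> real. D (fst p) = 0} \<in> sets borel" by measurable
  qed
  ultimately show "AE p in M. \<rho> p = 0"
    by eventually_elim auto
qed

theorem theorem2p4:
  fixes \<alpha> :: "real \<Rightarrow> real" and \<Gamma> :: "(real \<times> real) set"
  assumes "\<alpha> = (\<lambda>t. exp (t\<^sup>2))"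
    and "\<Gamma> = {(t, \<alpha> t) | t. True}"
  shows "(\<forall>\<Lambda>. line_parallel_X_axis \<Lambda> \<longrightarrow> heisenberg_uniqueness_pair \<Gamma> \<Lambda>) \<and>
    (\<forall>L\<^sub>1 L\<^sub>2. line_parallel_Y_axis L\<^sub>1 \<longrightarrow> line_parallel_Y_axis L\<^sub>2 \<longrightarrow> L\<^sub>1 \<noteq> L\<^sub>2 \<longrightarrow>
       heisenberg_uniqueness_pair \<Gamma> (L\<^sub>1 \<union> L\<^sub>2))"
proof -
  have "\<Gamma> = gauss_graph" using assms by (simp add: gauss_graph_def)
  then show ?thesis
    by (auto simp: line_parallel_X_axis_def line_parallel_Y_axis_def
        intro!: heisenberg_uniqueness_pair_horizontal heisenberg_uniqueness_pair_vertical)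
qed

end
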